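(* Let $p$ be a prime, $s$ a positive integer, and let $f_1,\ldots,f_s$ be nonnegative integers such that the coefficient of the monomial $x_1^{f_1}\cdots x_s^{f_s}$ in the polynomial $\prod_{1\leq i<j\leq s}(x_j-x_i)^2$ is non-zero modulo $p$. Then the sequence $(pf_1,\ldots,pf_s)$ is satisfying for $n=p$ and $k=2$; that is, whenever $\mathcal F_1,\ldots,\mathcal F_s\subset[p]^2$ satisfy $|\mathcal F_i|>pf_i$ for all $i\in[s]$, there exist pairwise disjoint $F_1\in\mathcal F_1,\ldots,F_s\in\mathcal F_s$.
   Context: $[p]^2$ is the set of pairs $(x_1,x_2)$ with $x_1,x_2\in\{1,\ldots,p\}$ (equivalently, edges of the complete bipartite graph $K_{p,p}$). Two pairs $(x_1,x_2)$ and $(y_1,y_2)$ are disjoint iff $x_1\neq y_1$ and $x_2\neq y_2$. A sequence $(g_1,\ldots,g_s)$ is satisfying (for $n=p$, $k=2$) if for all families $\mathcal F_1,\ldots,\mathcal F_s\subset[p]^2$ with $|\mathcal F_i|>g_i$ for each $i$, there exist pairwise disjoint $F_1\in\mathcal F_1,\ldots,F_s\in\mathcal F_s$. *)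

theory Defs
  imports "HOL-Computational_Algebra.Primes" "HOL-Library.Poly_Mapping"
begin

(* Integer polynomials in variables x_0, x_1, ...: finitely supported maps from
   exponent vectors to coefficients, multiplied by convolution. *)
type_synonym int_mpoly = "(nat \<Rightarrow>\<^sub>0 nat) \<Rightarrow>\<^sub>0 int"

definition X :: "nat \<Rightarrow> int_mpoly" where
  "X i = Poly_Mapping.single (Poly_Mapping.single i 1) 1"

(* The exponent vector of x_1^(f 1) * ... * x_s^(f s); values of f outside {1..s} are ignored. *)
definition exponents :: "nat \<Rightarrow> (nat \<Rightarrow> nat) \<Rightarrow> (nat \<Rightarrow>\<^sub>0 nat)" where
  "exponents s f = (\<Sum>i\<in>{1..s}. Poly_Mapping.single i (f i))"

definition coefficient :: "int_mpoly \<Rightarrow> (nat \<Rightarrow>\<^sub>0 nat) \<Rightarrow> int" where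
  "coefficient P m = Poly_Mapping.lookup P m"

definition vandermonde_square :: "nat \<Rightarrow> int_mpoly" where
  "vandermonde_square s =
     (\<Prod>(i, j)\<in>{(i, j) \<in> {1..s} \<times> {1..s}. i < j}. (X j - X i) ^ 2)"

(* Two edges of the complete bipartite graph K_{n,n} are disjoint when they share no endpoint;
   this is not disjointness of the coordinate sets, as (1,2) and (2,1) are disjoint edges. *)
definition disjoint_pairs :: "nat \<times> nat \<Rightarrow> nat \<times> nat \<Rightarrow> bool" where
  "disjoint_pairs x y \<longleftrightarrow> fst x \<noteq> fst y \<and> snd x \<noteq> snd y"

(* The case k = 2, for sequences (g 1, ..., g s). *)
definition satisfying :: "nat \<Rightarrow> nat \<Rightarrow> (nat \<Rightarrow> nat) \<Rightarrow> bool" where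
  "satisfying n s g \<longleftrightarrow>
     (\<forall>\<F> :: nat \<Rightarrow> (nat \<times> nat) set.
        (\<forall>i\<in>{1..s}. \<F> i \<subseteq> {1..n} \<times> {1..n} \<and> card (\<F> i) > g i) \<longrightarrow>
        (\<exists>F. (\<forall>i\<in>{1..s}. F i \<in> \<F> i) \<and>
             (\<forall>i\<in>{1..s}. \<forall>j\<in>{1..s}. i \<noteq> j \<longrightarrow> disjoint_pairs (F i) (F j))))"

end

(* Pigeonhole among the parallel lines y = x + c of F_p^2 gives, for each i, a line y = x + b_i that
   meets F_i in more than f_i points.  For points (x_i, x_i + b_i) on these lines, pairwise disjointness
   means that the product over i < j of (x_j - x_i) * (x_j - x_i + b_j - b_i) does not vanish modulo p.
   Its part of top degree is the squared Vandermonde product, so the Combinatorial Nullstellensatz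
   over F_p applies to the monomial with exponents f_1, ..., f_s. *)
theory Submission
  imports Defs "HOL-Number_Theory.Cong" "HOL-Library.FuncSet"
begin

section \<open>Evaluation of integer polynomials as a ring homomorphism\<close>

section \<open>Evaluation\<close>

text \<open>The product runs over a fixed set \<open>I\<close> and not over the keys of
  \<open>m\<close>, so that exponents of a product of monomials add up factor by factor. A variable
  outside \<open>I\<close> is in effect set to 1.\<close>

definition eval_mpoly :: "nat set \<Rightarrow> (nat \<Rightarrow> int) \<Rightarrow> int_mpoly \<Rightarrow> int" where
  "eval_mpoly I a P =
     (\<Sum>m\<in>Poly_Mapping.keys P. Poly_Mapping.lookup P m * (\<Prod>i\<in>I. a i ^ Poly_Mapping.lookup m i))"

lemma eval_mpoly_0 [simp]: "eval_mpoly I a 0 = 0"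
  by (simp add: eval_mpoly_def)

lemma eval_mpoly_single [simp]:
  "eval_mpoly I a (Poly_Mapping.single m c) = c * (\<Prod>i\<in>I. a i ^ Poly_Mapping.lookup m i)"
  by (simp add: eval_mpoly_def)

lemma eval_mpoly_add: "eval_mpoly I a (P + Q) = eval_mpoly I a P + eval_mpoly I a Q"
  unfolding eval_mpoly_def by (rule setsum_keys_plus_distrib) (simp_all add: distrib_right)

lemma eval_mpoly_diff: "eval_mpoly I a (P - Q) = eval_mpoly I a P - eval_mpoly I a Q"
  using eval_mpoly_add[of I a "P - Q" Q] by simp

lemma eval_mpoly_sum: "eval_mpoly I a (sum P T) = (\<Sum>t\<in>T. eval_mpoly I a (P t))"
  by (induction T rule: infinite_finite_induct) (simp_all add: eval_mpoly_add)

lemma sum_monomials: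
  "(\<Sum>m\<in>Poly_Mapping.keys P. Poly_Mapping.single m (Poly_Mapping.lookup P m)) = P"
  by (rule poly_mapping_eqI)
    (simp add: lookup_sum lookup_single when_def in_keys_iff sum.delta)

text \<open>Expanding both factors into monomials reduces the claim, by additivity, to the law of
  exponents.\<close>

lemma eval_mpoly_mult: "eval_mpoly I a (P * Q) = eval_mpoly I a P * eval_mpoly I a Q"
proof -
  let ?s = "\<lambda>P m. Poly_Mapping.single m (Poly_Mapping.lookup P m) :: int_mpoly"
  have "eval_mpoly I a (P * Q) = eval_mpoly I a
      ((\<Sum>m\<in>Poly_Mapping.keys P. ?s P m) * (\<Sum>n\<in>Poly_Mapping.keys Q. ?s Q n))"
    by (simp only: sum_monomials)
  also have "\<dots> = (\<Sum>m\<in>Poly_Mapping.keys P. \<Sum>n\<in>Poly_Mapping.keys Q.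
      eval_mpoly I a (?s P m) * eval_mpoly I a (?s Q n))"
    by (simp add: sum_product eval_mpoly_sum mult_single lookup_add power_add prod.distrib mult_ac)
  also have "\<dots> = eval_mpoly I a P * eval_mpoly I a Q"
    by (simp add: sum_product eval_mpoly_def[of _ _ P] eval_mpoly_def[of _ _ Q])
  finally show ?thesis .
qed

lemma eval_mpoly_1 [simp]: "eval_mpoly I a 1 = 1"
  using eval_mpoly_single[of I a 0 1] by (simp flip: single_one)

lemma eval_mpoly_prod: "eval_mpoly I a (prod P T) = (\<Prod>t\<in>T. eval_mpoly I a (P t))"
  by (induction T rule: infinite_finite_induct) (simp_all add: eval_mpoly_mult)

lemma eval_mpoly_X:
  assumes "finite I" "i \<in> I"
  shows "eval_mpoly I a (X i) = a i"
proof -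
  have "(\<Prod>k\<in>I. a k ^ Poly_Mapping.lookup (Poly_Mapping.single i 1) k) = (\<Prod>k\<in>I. if k = i then a k else 1)"
    by (rule prod.cong) (auto simp: lookup_single when_def)
  then show ?thesis
    using assms by (simp add: X_def)
qed

section \<open>Variables and total degrees of polynomials\<close>

section \<open>Degrees\<close>

text \<open>A set \<open>D\<close> of admissible degrees lets one predicate cover homogeneous forms
  (\<open>{d}\<close>), bounded degree (\<open>{..d}\<close>) and lower-order terms
  (\<open>{..<d}\<close>). The zero polynomial qualifies for every \<open>D\<close>, so it needs no
  degree of its own.\<close>

definition degrees_in :: "nat set \<Rightarrow> nat set \<Rightarrow> int_mpoly \<Rightarrow> bool" where
  "degrees_in I D P \<longleftrightarrow> (\<forall>m\<in>Poly_Mapping.keys P.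
     Poly_Mapping.keys m \<subseteq> I \<and> (\<Sum>i\<in>I. Poly_Mapping.lookup m i) \<in> D)"

lemma degrees_in_mono: "degrees_in I D P \<Longrightarrow> D \<subseteq> E \<Longrightarrow> degrees_in I E P"
  unfolding degrees_in_def by blast

lemma degrees_in_0 [simp]: "degrees_in I D 0"
  by (simp add: degrees_in_def)

lemma degrees_in_1: "0 \<in> D \<Longrightarrow> degrees_in I D 1"
  by (simp add: degrees_in_def)

lemma degrees_in_const: "0 \<in> D \<Longrightarrow> degrees_in I D (Poly_Mapping.single 0 c)"
  by (simp add: degrees_in_def)

lemma degrees_in_X:
  assumes "finite I" "i \<in> I"
  shows "degrees_in I {1} (X i)"
proof -
  have "(\<Sum>k\<in>I. Poly_Mapping.lookup (Poly_Mapping.single i (1::nat)) k) = (\<Sum>k\<in>I. if k = i then 1 else 0)"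
    by (rule sum.cong) (auto simp: lookup_single when_def)
  then show ?thesis
    using assms by (simp add: degrees_in_def X_def)
qed

lemma degrees_in_add: "degrees_in I D P \<Longrightarrow> degrees_in I D Q \<Longrightarrow> degrees_in I D (P + Q)"
  using keys_add[of P Q] unfolding degrees_in_def by blast

lemma degrees_in_diff: "degrees_in I D P \<Longrightarrow> degrees_in I D Q \<Longrightarrow> degrees_in I D (P - Q)"
  using keys_diff[of P Q] unfolding degrees_in_def by blast

lemma degrees_in_mult:
  assumes P: "degrees_in I D P" and Q: "degrees_in I E Q"
    and F: "\<And>d e. d \<in> D \<Longrightarrow> e \<in> E \<Longrightarrow> d + e \<in> F"
  shows "degrees_in I F (P * Q)"
  unfolding degrees_in_def
proof
  fix m assume "m \<in> Poly_Mapping.keys (P * Q)"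
  then obtain k l where m: "m = k + l" and "k \<in> Poly_Mapping.keys P" "l \<in> Poly_Mapping.keys Q"
    using keys_mult[of P Q] by blast
  with P Q have "Poly_Mapping.keys k \<subseteq> I" "Poly_Mapping.keys l \<subseteq> I"
    and "(\<Sum>i\<in>I. Poly_Mapping.lookup k i) \<in> D" "(\<Sum>i\<in>I. Poly_Mapping.lookup l i) \<in> E"
    unfolding degrees_in_def by blast+
  then show "Poly_Mapping.keys m \<subseteq> I \<and> (\<Sum>i\<in>I. Poly_Mapping.lookup m i) \<in> F"
    using keys_add[of k l] F by (auto simp: m lookup_add sum.distrib)
qed

text \<open>Leading forms multiply: with each \<open>R t\<close> written as \<open>Q t\<close> plus
  an error of lower degree, every term of the expanded product that contains an error has degree
  below the total.\<close>

lemma top_degree_prod: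
  assumes "finite T"
    and "\<And>t. t \<in> T \<Longrightarrow> degrees_in I {d t} (Q t)"
    and "\<And>t. t \<in> T \<Longrightarrow> degrees_in I {..<d t} (R t - Q t)"
  shows "degrees_in I {sum d T} (prod Q T) \<and> degrees_in I {..<sum d T} (prod R T - prod Q T)"
  using assms
proof (induction T)
  case empty
  then show ?case by (simp add: degrees_in_1)
next
  case (insert t T)
  let ?n = "sum d T"
  have Q: "degrees_in I {?n} (prod Q T)" and lower: "degrees_in I {..<?n} (prod R T - prod Q T)"
    using insert by auto
  have Qt: "degrees_in I {d t} (Q t)" and lower_t: "degrees_in I {..<d t} (R t - Q t)"
    using insert by auto
  have "degrees_in I {d t + ?n} (Q t * prod Q T)"
    by (rule degrees_in_mult[OF Qt Q]) auto
  \<comment> \<open>The three summands are the mixed terms of (\<open>Q t\<close> + error) times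
    (\<open>prod Q T\<close> + error), without the product of the two leading forms.\<close>
  moreover have "degrees_in I {..<d t + ?n}
      (Q t * (prod R T - prod Q T) + (R t - Q t) * (prod R T - prod Q T) + (R t - Q t) * prod Q T)"
    by (intro degrees_in_add degrees_in_mult[OF Qt lower] degrees_in_mult[OF lower_t lower]
        degrees_in_mult[OF lower_t Q]) auto
  moreover have "Q t * (prod R T - prod Q T) + (R t - Q t) * (prod R T - prod Q T)
      + (R t - Q t) * prod Q T = R t * prod R T - Q t * prod Q T"
    by (simp add: algebra_simps)
  ultimately show ?case
    using insert.hyps by simp
qed

section \<open>The coefficient of a top-degree monomial as a weighted sum over a grid\<close>

section \<open>The Combinatorial Nullstellensatz modulo a prime\<close>

(* These are the weights of the divided difference on A, built without division by adjoining
   one point b at a time: the weight of a is divided by a - b. *)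
lemma top_power_weights:
  fixes A :: "int set" and p :: nat
  assumes "prime p" "card A = Suc d" "inj_on (\<lambda>a. a mod int p) A"
  shows "\<exists>w. \<forall>k\<le>d. [(\<Sum>a\<in>A. w a * a ^ k) = (if k = d then 1 else 0)] (mod int p)"
  using assms(2,3)
proof (induction d arbitrary: A)
  case 0
  then obtain a where "A = {a}"
    by (auto simp: card_1_singleton_iff)
  then show ?case
    by (intro exI[of _ "\<lambda>_. 1"]) simp
next
  case (Suc d)
  then obtain b B where A: "A = insert b B" "b \<notin> B" "card B = Suc d"
    by (metis card_Suc_eq)
  have "finite B"
    using A(3) by (simp add: card_ge_0_finite)
  obtain w where w: "\<forall>k\<le>d. [(\<Sum>a\<in>B. w a * a ^ k) = (if k = d then 1 else 0)] (mod int p)"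
    using Suc.IH[OF A(3)] Suc.prems(2) A(1) by (auto intro: inj_on_subset)
  have "\<exists>c. [(a - b) * c = 1] (mod int p)" if "a \<in> B" for a
  proof -
    have "a mod int p \<noteq> b mod int p"
      using Suc.prems(2) A that by (auto simp: inj_on_def)
    then have "\<not> int p dvd a - b"
      by (simp add: mod_eq_dvd_iff)
    then have "coprime (a - b) (int p)"
      using \<open>prime p\<close> by (simp add: prime_imp_coprime coprime_commute)
    then show ?thesis
      by (rule cong_solve_coprime_int)
  qed
  then obtain c where c: "\<And>a. a \<in> B \<Longrightarrow> [(a - b) * c a = 1] (mod int p)"
    by metis
  \<comment> \<open>Off \<open>b\<close> the old weight is divided by \<open>a - b\<close> modulo
    \<open>p\<close>; the weight at \<open>b\<close> is chosen to make all weights sum to 0.\<close>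
  define v where "v a = (if a = b then - (\<Sum>a\<in>B. w a * c a) else w a * c a)" for a
  define S where "S k = (\<Sum>a\<in>A. v a * a ^ k)" for k
  have v: "(\<Sum>a\<in>B. v a * g a) = (\<Sum>a\<in>B. w a * c a * g a)" for g
    using A(2) by (intro sum.cong) (auto simp: v_def)
  have S0: "S 0 = 0"
    using A(2) \<open>finite B\<close> v[of "\<lambda>_. 1"] by (simp add: S_def A(1)) (simp add: v_def)
  \<comment> \<open>In \<open>S (Suc k) - b * S k\<close> the factor \<open>a - b\<close> kills the
    term at the new point and cancels against \<open>c a\<close> elsewhere, leaving the moment of
    the old weights.\<close>
  have S_Suc: "[S (Suc k) = b * S k + (\<Sum>a\<in>B. w a * a ^ k)] (mod int p)" for k
  proof -
    have "S (Suc k) - b * S k = (\<Sum>a\<in>A. v a * ((a - b) * a ^ k))"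
      by (simp add: S_def sum_distrib_left algebra_simps flip: sum_subtractf)
    also have "\<dots> = (\<Sum>a\<in>B. ((a - b) * c a) * (w a * a ^ k))"
      using A(2) \<open>finite B\<close> v[of "\<lambda>a. (a - b) * a ^ k"] by (simp add: A(1) mult_ac)
    also have "[\<dots> = (\<Sum>a\<in>B. 1 * (w a * a ^ k))] (mod int p)"
      by (intro cong_sum cong_scalar_right c)
    finally show ?thesis
      by (simp add: cong_iff_dvd_diff algebra_simps)
  qed
  \<comment> \<open>Starting from \<open>S 0 = 0\<close>, the recurrence keeps the moments at 0
    until the old weights contribute their 1 at \<open>k = d\<close>, which lands at
    \<open>Suc d\<close>.\<close>
  have "[S k = (if k = Suc d then 1 else 0)] (mod int p)" if "k \<le> Suc d" for k
    using that
  proof (induction k)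
    case 0
    then show ?case by (simp add: S0)
  next
    case (Suc k)
    then have "[S k = 0] (mod int p)"
      and "[(\<Sum>a\<in>B. w a * a ^ k) = (if k = d then 1 else 0)] (mod int p)"
      using w by auto
    then have "[b * S k + (\<Sum>a\<in>B. w a * a ^ k) = b * 0 + (if k = d then 1 else 0)] (mod int p)"
      by (intro cong_add cong_scalar_left)
    with S_Suc[of k] show ?case
      by (auto intro: cong_trans)
  qed
  then show ?case
    unfolding S_def by blast
qed

lemma lookup_monomial:
  assumes "finite I"
  shows "Poly_Mapping.lookup (\<Sum>i\<in>I. Poly_Mapping.single i (f i)) k = (if k \<in> I then f k else 0)"
  using assms by (simp add: lookup_sum lookup_single when_def sum.delta)

text \<open>If every exponent were at least \<open>f i\<close>, the bound on their sum would force
  equality throughout. This singles out the target monomial among those of no larger degree.\<close>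

lemma exists_small_exponent:
  fixes m :: "nat \<Rightarrow>\<^sub>0 nat"
  assumes "finite I" "Poly_Mapping.keys m \<subseteq> I"
    and "(\<Sum>i\<in>I. Poly_Mapping.lookup m i) \<le> sum f I"
    and "m \<noteq> (\<Sum>i\<in>I. Poly_Mapping.single i (f i))"
  shows "\<exists>i\<in>I. Poly_Mapping.lookup m i < f i"
proof (rule ccontr)
  assume "\<not> ?thesis"
  then have ge: "f i \<le> Poly_Mapping.lookup m i" if "i \<in> I" for i
    using that by (simp add: not_less)
  have eq: "Poly_Mapping.lookup m i = f i" if "i \<in> I" for i
  proof (rule ccontr)
    assume "Poly_Mapping.lookup m i \<noteq> f i"
    then have "f i < Poly_Mapping.lookup m i"
      using ge[OF that] by simp
    then have "sum f I < (\<Sum>i\<in>I. Poly_Mapping.lookup m i)"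
      using assms(1) that ge by (intro sum_strict_mono_ex1) auto
    with assms(3) show False by simp
  qed
  have "m = (\<Sum>i\<in>I. Poly_Mapping.single i (f i))"
    using assms(2) eq
    by (intro poly_mapping_eqI) (auto simp: lookup_monomial[OF assms(1)] in_keys_iff subset_iff)
  with assms(4) show False ..
qed

text \<open>Summing the values of \<open>P\<close> over a grid, with a product of one-variable
  weights, gives the target coefficient modulo \<open>p\<close>. If \<open>p\<close> divided all
  these values, it would divide that coefficient. Points of F_p are represented by integers that are
  distinct modulo \<open>p\<close>.\<close>

theorem combinatorial_nullstellensatz_mod:
  fixes p :: nat and A :: "nat \<Rightarrow> int set"
  assumes p: "prime p" and I: "finite I"
    and deg: "degrees_in I {..sum f I} P"
    and coeff: "\<not> int p dvd Poly_Mapping.lookup P (\<Sum>i\<in>I. Poly_Mapping.single i (f i))"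
    and A: "\<And>i. i \<in> I \<Longrightarrow> card (A i) > f i"
    and inj: "\<And>i. i \<in> I \<Longrightarrow> inj_on (\<lambda>a. a mod int p) (A i)"
  shows "\<exists>a. (\<forall>i\<in>I. a i \<in> A i) \<and> \<not> int p dvd eval_mpoly I a P"
proof (rule ccontr)
  assume "\<not> ?thesis"
  then have vanish: "int p dvd eval_mpoly I a P" if "\<forall>i\<in>I. a i \<in> A i" for a
    using that by blast
  let ?f = "\<Sum>i\<in>I. Poly_Mapping.single i (f i)"
  \<comment> \<open>The weights isolate the power \<open>f i\<close> only on sets of exactly
    \<open>f i + 1\<close> points, so each \<open>A i\<close> is cut down to that size.\<close>
  have "\<exists>B. B \<subseteq> A i \<and> card B = Suc (f i)" if "i \<in> I" for i
    using A[OF that] obtain_subset_with_card_n[of "Suc (f i)" "A i"] by (auto simp: Suc_le_eq)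
  then obtain B where B: "\<And>i. i \<in> I \<Longrightarrow> B i \<subseteq> A i" "\<And>i. i \<in> I \<Longrightarrow> card (B i) = Suc (f i)"
    by metis
  have finB: "finite (B i)" if "i \<in> I" for i
    using B(2)[OF that] by (simp add: card_ge_0_finite)
  have "\<exists>w. \<forall>k\<le>f i. [(\<Sum>a\<in>B i. w a * a ^ k) = (if k = f i then 1 else 0)] (mod int p)"
    if "i \<in> I" for i
    using top_power_weights[OF p B(2)[OF that] inj_on_subset[OF inj[OF that] B(1)[OF that]]] .
  then obtain w where w: "\<And>i k. i \<in> I \<Longrightarrow> k \<le> f i \<Longrightarrow>
      [(\<Sum>a\<in>B i. w i a * a ^ k) = (if k = f i then 1 else 0)] (mod int p)"
    by metis
  \<comment> \<open>The weighted grid sum of the monomial \<open>m\<close>, already factored into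
    one sum per variable.\<close>
  define \<mu> where "\<mu> m = (\<Prod>i\<in>I. \<Sum>a\<in>B i. w i a * a ^ Poly_Mapping.lookup m i)" for m
  have \<mu>_f: "[\<mu> ?f = 1] (mod int p)"
  proof -
    have "[\<mu> ?f = (\<Prod>i\<in>I. 1)] (mod int p)"
      unfolding \<mu>_def using w[OF _ order_refl] by (intro cong_prod) (simp add: lookup_monomial[OF I])
    then show ?thesis by simp
  qed
  have \<mu>_other: "int p dvd \<mu> m" if m: "m \<in> Poly_Mapping.keys P" "m \<noteq> ?f" for m
  proof -
    have "Poly_Mapping.keys m \<subseteq> I" "(\<Sum>i\<in>I. Poly_Mapping.lookup m i) \<le> sum f I"
      using deg m(1) by (auto simp: degrees_in_def)
    then obtain i where "i \<in> I" "Poly_Mapping.lookup m i < f i"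
      using exists_small_exponent[OF I _ _ m(2)] by blast
    then have "int p dvd (\<Sum>a\<in>B i. w i a * a ^ Poly_Mapping.lookup m i)"
      using w[of i "Poly_Mapping.lookup m i"] by (simp add: cong_0_iff)
    then show ?thesis
      unfolding \<mu>_def using I \<open>i \<in> I\<close> by (meson dvd_prod_eqI dvd_prodI dvd_trans)
  qed
  \<comment> \<open>This sum is computed in two ways: through the monomials of \<open>P\<close>,
    where only \<open>?f\<close> survives modulo \<open>p\<close>, and through its values, all
    divisible by \<open>p\<close> by assumption.\<close>
  let ?L = "\<Sum>a\<in>PiE I B. (\<Prod>i\<in>I. w i (a i)) * eval_mpoly I a P"
  have "?L = (\<Sum>m\<in>Poly_Mapping.keys P. Poly_Mapping.lookup P m * \<mu> m)"
  proof -
    have "?L = (\<Sum>m\<in>Poly_Mapping.keys P. Poly_Mapping.lookup P m *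
        (\<Sum>a\<in>PiE I B. \<Prod>i\<in>I. w i (a i) * a i ^ Poly_Mapping.lookup m i))"
      unfolding eval_mpoly_def sum_distrib_left
      by (subst sum.swap) (simp add: prod.distrib mult_ac)
    then show ?thesis
      unfolding \<mu>_def using I finB by (simp add: prod_sum_PiE)
  qed
  \<comment> \<open>A coefficient not divisible by \<open>p\<close> is nonzero, so \<open>?f\<close>
    is a key of \<open>P\<close> and can be split off.\<close>
  also have "\<dots> = Poly_Mapping.lookup P ?f * \<mu> ?f +
      (\<Sum>m\<in>Poly_Mapping.keys P - {?f}. Poly_Mapping.lookup P m * \<mu> m)"
    using coeff by (subst sum.remove[of _ ?f]) (auto simp: in_keys_iff)
  finally have L: "?L = Poly_Mapping.lookup P ?f * \<mu> ?f +
      (\<Sum>m\<in>Poly_Mapping.keys P - {?f}. Poly_Mapping.lookup P m * \<mu> m)" .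
  have "int p dvd (\<Sum>m\<in>Poly_Mapping.keys P - {?f}. Poly_Mapping.lookup P m * \<mu> m)"
    using \<mu>_other by (intro dvd_sum) auto
  moreover have "int p dvd ?L"
  proof (intro dvd_sum dvd_mult vanish ballI)
    fix a i assume "a \<in> PiE I B" "i \<in> I"
    then show "a i \<in> A i" using B(1) by blast
  qed
  ultimately have "int p dvd Poly_Mapping.lookup P ?f * \<mu> ?f"
    unfolding L by (simp add: dvd_add_left_iff)
  moreover have "[Poly_Mapping.lookup P ?f * \<mu> ?f = Poly_Mapping.lookup P ?f * 1] (mod int p)"
    using \<mu>_f by (rule cong_scalar_left)
  ultimately show False
    using coeff cong_dvd_iff[of _ _ "int p"] cong_0_iff by (metis cong_sym cong_trans mult.right_neutral)
qed

section \<open>Parallel lines modulo \<open>p\<close> and the choice of edges\<close>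

section \<open>Disjoint edges\<close>

lemma inj_on_mod_atLeastAtMost: "inj_on (\<lambda>x. int x mod int p) {1..p}"
proof (rule inj_onI)
  fix x y assume xy: "x \<in> {1..p}" "y \<in> {1..p}" and eq: "int x mod int p = int y mod int p"
  then have "int p dvd int x - int y"
    by (simp add: mod_eq_dvd_iff)
  moreover have "\<bar>int x - int y\<bar> < int p"
    using xy by auto
  ultimately show "x = y"
    using zdvd_not_zless[of "\<bar>int x - int y\<bar>" "int p"] by fastforce
qed

text \<open>The \<open>p\<close> residues of second minus first coordinate split the family into
  \<open>p\<close> classes, one of which has more than \<open>d\<close> members. \<open>A\<close>
  consists of the first coordinates of that class.\<close>

lemma rich_diagonal_line:
  assumes "p > 0" "\<F> \<subseteq> {1..p} \<times> {1..p}" "card \<F> > p * d"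
  shows "\<exists>b A. card A > d \<and> inj_on (\<lambda>a. a mod int p) A \<and>
    (\<forall>a\<in>A. \<exists>F\<in>\<F>. int (fst F) = a \<and> [int (snd F) = a + b] (mod int p))"
proof -
  define h where "h F = (int (snd F) - int (fst F)) mod int p" for F :: "nat \<times> nat"
  have "finite \<F>"
    using assms(2) by (rule finite_subset) simp
  moreover have "h \<in> \<F> \<rightarrow> {0..<int p}"
    using assms(1) by (simp add: h_def)
  ultimately obtain b where "card (h -` {b} \<inter> \<F>) * p \<ge> card \<F>"
    using pigeonhole_card[of h \<F> "{0..<int p}"] assms(1) by auto
  then have "p * d < p * card (h -` {b} \<inter> \<F>)"
    using assms(3) by (metis mult.commute order_less_le_trans)
  then have gt: "d < card (h -` {b} \<inter> \<F>)"
    by simp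
  define G where "G = h -` {b} \<inter> \<F>"
  have line: "[int (snd F) = int (fst F) + b] (mod int p)" if "F \<in> G" for F
    using that unfolding G_def h_def cong_def by (auto simp: mod_simps)
  have sub: "fst F \<in> {1..p}" "snd F \<in> {1..p}" if "F \<in> G" for F
    using that assms(2) by (auto simp: G_def)
  \<comment> \<open>On one line the first coordinate fixes the second modulo \<open>p\<close>, hence
    exactly within \<open>{1..p}\<close>; projecting loses no points.\<close>
  have "inj_on (\<lambda>F. int (fst F)) G"
  proof (rule inj_onI)
    fix F F' assume FF: "F \<in> G" "F' \<in> G" and eq: "int (fst F) = int (fst F')"
    have "int (snd F) mod int p = int (snd F') mod int p"
      using line[OF FF(1)] line[OF FF(2)] eq by (simp add: cong_def)
    then have "snd F = snd F'"
      using inj_onD[OF inj_on_mod_atLeastAtMost] sub FF by blast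
    with eq show "F = F'" by (simp add: prod_eq_iff)
  qed
  then have "card ((\<lambda>F. int (fst F)) ` G) > d"
    using gt by (simp add: card_image G_def)
  moreover have "inj_on (\<lambda>a. a mod int p) ((\<lambda>F. int (fst F)) ` G)"
  proof (rule inj_onI)
    fix x y assume "x \<in> (\<lambda>F. int (fst F)) ` G" "y \<in> (\<lambda>F. int (fst F)) ` G"
      and eq: "x mod int p = y mod int p"
    then obtain F F' where FF: "F \<in> G" "F' \<in> G" and xy: "x = int (fst F)" "y = int (fst F')"
      by blast
    have "fst F = fst F'"
      using inj_onD[OF inj_on_mod_atLeastAtMost eq[unfolded xy]] sub(1) FF by blast
    then show "x = y" by (simp add: xy)
  qed
  moreover have "\<forall>a\<in>(\<lambda>F. int (fst F)) ` G. \<exists>F\<in>\<F>. int (fst F) = a \<and> [int (snd F) = a + b] (mod int p)"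
    using line by (auto simp: G_def)
  ultimately show ?thesis by blast
qed

theorem theorem3:
  fixes p s :: nat and f :: "nat \<Rightarrow> nat"
  assumes "prime p"
    and "s \<ge> 1"
    and "\<not> int p dvd coefficient (vandermonde_square s) (exponents s f)"
  shows "satisfying p s (\<lambda>i. p * f i)"
  unfolding satisfying_def
proof (intro allI impI)
  fix \<F> :: "nat \<Rightarrow> (nat \<times> nat) set"
  assume \<F>: "\<forall>i\<in>{1..s}. \<F> i \<subseteq> {1..p} \<times> {1..p} \<and> card (\<F> i) > p * f i"
  let ?I = "{1..s}"
  let ?T = "{(i, j) \<in> ?I \<times> ?I. i < j}"
  have "\<exists>b A. card A > f i \<and> inj_on (\<lambda>a. a mod int p) A \<and>
      (\<forall>a\<in>A. \<exists>F\<in>\<F> i. int (fst F) = a \<and> [int (snd F) = a + b] (mod int p))" if "i \<in> ?I" for i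
    using that \<F> \<open>prime p\<close> by (intro rich_diagonal_line) (auto simp: prime_gt_0_nat)
  then obtain b A where A: "\<And>i. i \<in> ?I \<Longrightarrow> card (A i) > f i"
      "\<And>i. i \<in> ?I \<Longrightarrow> inj_on (\<lambda>a. a mod int p) (A i)"
    and line: "\<And>i a. i \<in> ?I \<Longrightarrow> a \<in> A i \<Longrightarrow>
      \<exists>F\<in>\<F> i. int (fst F) = a \<and> [int (snd F) = a + b i] (mod int p)"
    by metis
  define Q :: "nat \<times> nat \<Rightarrow> int_mpoly" where "Q = (\<lambda>(i, j). (X j - X i) ^ 2)"
  \<comment> \<open>The two factors detect a clash modulo \<open>p\<close> in the first and in the
    second coordinate. Dropping the constant \<open>b j - b i\<close> leaves the leading form
    \<open>Q\<close>.\<close>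
  define R :: "nat \<times> nat \<Rightarrow> int_mpoly" where
    "R = (\<lambda>(i, j). (X j - X i) * (X j - X i + Poly_Mapping.single 0 (b j - b i)))"
  have finT: "finite ?T"
    by (rule finite_subset[of _ "?I \<times> ?I"]) auto
  have V: "vandermonde_square s = prod Q ?T"
    by (simp add: vandermonde_square_def Q_def)
  have "degrees_in ?I {2} (Q t)" "degrees_in ?I {..<2} (R t - Q t)" if t: "t \<in> ?T" for t
  proof -
    obtain i j where ij: "t = (i, j)" "i \<in> ?I" "j \<in> ?I"
      using t by blast
    have lin: "degrees_in ?I {1} (X j - X i)"
      using ij by (intro degrees_in_diff degrees_in_X) auto
    show "degrees_in ?I {2} (Q t)"
      unfolding ij(1) Q_def prod.case power2_eq_square by (rule degrees_in_mult[OF lin lin]) auto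
    have "degrees_in ?I {..<2} ((X j - X i) * Poly_Mapping.single 0 (b j - b i))"
      by (rule degrees_in_mult[OF lin degrees_in_const[of "{0}"]]) auto
    moreover have "R t - Q t = (X j - X i) * Poly_Mapping.single 0 (b j - b i)"
      by (simp add: ij(1) Q_def R_def power2_eq_square algebra_simps)
    ultimately show "degrees_in ?I {..<2} (R t - Q t)" by simp
  qed
  then have top: "degrees_in ?I {\<Sum>t\<in>?T. 2} (prod Q ?T)"
      "degrees_in ?I {..<\<Sum>t\<in>?T. 2} (prod R ?T - prod Q ?T)"
    using top_degree_prod[OF finT, of ?I "\<lambda>_. 2" Q R] by blast+
  have "\<not> int p dvd Poly_Mapping.lookup (prod Q ?T) (exponents s f)"
    using assms(3) by (simp add: coefficient_def V)
  \<comment> \<open>Since \<open>prod Q ?T\<close> is homogeneous, a nonzero coefficient at this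
    monomial forces the sum of the \<open>f i\<close> to equal its degree.\<close>
  then have "exponents s f \<in> Poly_Mapping.keys (prod Q ?T)"
    by (auto simp: in_keys_iff)
  then have "(\<Sum>i\<in>?I. Poly_Mapping.lookup (exponents s f) i) = (\<Sum>t\<in>?T. 2)"
    using top(1) by (auto simp: degrees_in_def)
  moreover have "(\<Sum>i\<in>?I. Poly_Mapping.lookup (exponents s f) i) = sum f ?I"
    by (simp add: exponents_def lookup_monomial)
  ultimately have deg: "(\<Sum>t\<in>?T. 2) = sum f ?I" by simp
  \<comment> \<open>The lower-order terms cannot reach this degree, so \<open>prod R ?T\<close> and
    \<open>prod Q ?T\<close> have the same coefficient here.\<close>
  have "exponents s f \<notin> Poly_Mapping.keys (prod R ?T - prod Q ?T)"
    using top(2) deg by (auto simp: degrees_in_def exponents_def lookup_monomial)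
  then have coeff: "\<not> int p dvd Poly_Mapping.lookup (prod R ?T) (exponents s f)"
    using assms(3) by (simp add: coefficient_def V in_keys_iff lookup_minus)
  have "degrees_in ?I {..sum f ?I} (prod Q ?T + (prod R ?T - prod Q ?T))"
    using top unfolding deg by (intro degrees_in_add) (auto elim!: degrees_in_mono)
  then have "degrees_in ?I {..sum f ?I} (prod R ?T)" by simp
  then obtain a where a: "\<forall>i\<in>?I. a i \<in> A i" and nz: "\<not> int p dvd eval_mpoly ?I a (prod R ?T)"
    using combinatorial_nullstellensatz_mod[of p ?I f "prod R ?T" A] assms(1) A coeff
    unfolding exponents_def by blast
  have "\<exists>F. F \<in> \<F> i \<and> int (fst F) = a i \<and> [int (snd F) = a i + b i] (mod int p)" if "i \<in> ?I" for i
    using line[of i "a i"] a that by blast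
  then obtain F where F: "\<And>i. i \<in> ?I \<Longrightarrow> F i \<in> \<F> i" "\<And>i. i \<in> ?I \<Longrightarrow> int (fst (F i)) = a i"
      "\<And>i. i \<in> ?I \<Longrightarrow> [int (snd (F i)) = a i + b i] (mod int p)"
    by metis
  have disj: "disjoint_pairs (F i) (F j)" if "i \<in> ?I" "j \<in> ?I" "i < j" for i j
  proof -
    \<comment> \<open>Each factor divides the product, so a product that is nonzero modulo
      \<open>p\<close> rules out a clash for every pair at once.\<close>
    have "eval_mpoly ?I a (R (i, j)) dvd eval_mpoly ?I a (prod R ?T)"
      unfolding eval_mpoly_prod using finT that by (intro dvd_prodI) auto
    then have "\<not> int p dvd eval_mpoly ?I a (R (i, j))"
      using nz dvd_trans by blast
    then have "\<not> int p dvd (a j - a i) * (a j - a i + (b j - b i))"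
      using that by (simp add: R_def eval_mpoly_mult eval_mpoly_add eval_mpoly_diff eval_mpoly_X)
    then have n1: "a i \<noteq> a j" and n2: "\<not> int p dvd a j - a i + (b j - b i)"
      by auto
    have "fst (F i) \<noteq> fst (F j)"
      using n1 F(2) that by metis
    moreover have "snd (F i) \<noteq> snd (F j)"
    proof
      assume "snd (F i) = snd (F j)"
      \<comment> \<open>Second coordinates are known only modulo \<open>p\<close>, so their equality
        gives a congruence, which \<open>n2\<close> excludes.\<close>
      then have "[a j + b j = a i + b i] (mod int p)"
        using F(3) that by (metis cong_sym cong_trans)
      with n2 show False
        by (simp add: cong_iff_dvd_diff algebra_simps)
    qed
    ultimately show ?thesis by (simp add: disjoint_pairs_def)
  qed
  have "disjoint_pairs (F i) (F j)" if "i \<in> ?I" "j \<in> ?I" "i \<noteq> j" for i j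
    using disj[of i j] disj[of j i] that by (auto simp: disjoint_pairs_def neq_iff)
  with F(1) show "\<exists>F. (\<forall>i\<in>?I. F i \<in> \<F> i) \<and>
      (\<forall>i\<in>?I. \<forall>j\<in>?I. i \<noteq> j \<longrightarrow> disjoint_pairs (F i) (F j))"
    by blast
qed

end
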